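(* For a positive integer $m$ let $\psi_m(x)$ be the minimal polynomial (over $\mathbb{Q}$) of the algebraic integer $2\cos\frac{2\pi}{m}$. Let $n\ge 1$ be an integer. Then $$U_n(x)=\prod_{\substack{j\mid 2n+2\\ j\neq 1,2}}\psi_j(2x).$$ Moreover, write $n=2^{\alpha}N$ with $\alpha\ge 0$ and $N$ odd, and let $r=2^{\alpha+2}$. Then $$T_n(x)=\frac12\prod_{j\mid N}\psi_{rj}(2x).$$ Here $j$ runs over positive divisors in both products.
   Context: $T_n$ and $U_n$ are the Chebyshev polynomials of the first and second kind, defined by $T_0=1$, $T_1=x$, $T_{n+1}=2xT_n-T_{n-1}$ and $U_0=1$, $U_1=2x$, $U_{n+1}=2xU_n-U_{n-1}$. Minimal polynomials are monic. *)

theory Defs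
  imports Complex_Main "HOL-Computational_Algebra.Polynomial"
begin

fun cheb_T :: "nat \<Rightarrow> 'a :: comm_ring_1 poly" where
  "cheb_T 0 = 1"
| "cheb_T (Suc 0) = [:0, 1:]"
| "cheb_T (Suc (Suc n)) = [:0, 2:] * cheb_T (Suc n) - cheb_T n"

fun cheb_U :: "nat \<Rightarrow> 'a :: comm_ring_1 poly" where
  "cheb_U 0 = 1"
| "cheb_U (Suc 0) = [:0, 2:]"
| "cheb_U (Suc (Suc n)) = [:0, 2:] * cheb_U (Suc n) - cheb_U n"

definition is_min_poly_rat :: "'a :: field_char_0 \<Rightarrow> rat poly \<Rightarrow> bool" where
  "is_min_poly_rat x p \<longleftrightarrow>
     lead_coeff p = 1 \<and> poly (map_poly of_rat p) x = 0 \<and>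
     (\<forall>q. q \<noteq> 0 \<and> poly (map_poly of_rat q) x = 0 \<longrightarrow> degree p \<le> degree q)"

(* Only meaningful for algebraic x; see is_min_poly_rat_min_poly_rat below. *)
definition min_poly_rat :: "'a :: field_char_0 \<Rightarrow> rat poly" where
  "min_poly_rat x = (THE p. is_min_poly_rat x p)"

definition psi :: "nat \<Rightarrow> rat poly" where
  "psi m = min_poly_rat (2 * cos (2 * pi / real m))"

lemma map_poly_of_rat_diff:
  "map_poly (of_rat :: rat \<Rightarrow> 'a :: field_char_0) (p - q) = map_poly of_rat p - map_poly of_rat q"
  by (rule poly_eqI) (simp add: coeff_map_poly of_rat_diff)

lemma is_min_poly_rat_unique:
  assumes p: "is_min_poly_rat x p" and q: "is_min_poly_rat x q"
  shows "p = q"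
proof (rule ccontr)
  assume "p \<noteq> q"
  hence nz: "p - q \<noteq> 0" by simp
  have "p \<noteq> 0" "q \<noteq> 0" using p q by (auto simp: is_min_poly_rat_def)
  hence deg: "degree p = degree q"
    using p q by (auto simp: is_min_poly_rat_def intro: antisym)
  have "poly (map_poly of_rat (p - q)) x = 0"
    using p q by (simp add: is_min_poly_rat_def map_poly_of_rat_diff)
  hence le: "degree p \<le> degree (p - q)"
    using p nz by (auto simp: is_min_poly_rat_def)
  have "degree (p - q) \<le> degree p"
    using degree_diff_le_max[of p q] deg by simp
  with le have eq: "degree (p - q) = degree p" by simp
  have "coeff (p - q) (degree p) = 0"
    using p q deg by (simp add: is_min_poly_rat_def)
  with nz eq show False by (metis leading_coeff_0_iff)
qed

lemma is_min_poly_rat_min_poly_rat: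
  assumes "q0 \<noteq> 0" "poly (map_poly of_rat q0) x = 0"
  shows "is_min_poly_rat x (min_poly_rat x)"
proof -
  let ?P = "\<lambda>q. q \<noteq> 0 \<and> poly (map_poly of_rat q) x = 0"
  obtain p where p: "?P p" and min: "\<And>q. ?P q \<Longrightarrow> degree p \<le> degree q"
    using arg_min_nat_lemma[of ?P q0 degree] assms by blast
  define p' where "p' = smult (inverse (lead_coeff p)) p"
  have "map_poly (of_rat :: rat \<Rightarrow> 'a) p' =
          smult (of_rat (inverse (lead_coeff p))) (map_poly of_rat p)"
    unfolding p'_def by (rule poly_eqI) (simp add: coeff_map_poly of_rat_mult)
  hence "is_min_poly_rat x p'"
    using p min by (auto simp: is_min_poly_rat_def p'_def)
  thus ?thesis
    unfolding min_poly_rat_def using is_min_poly_rat_unique by (metis theI)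
qed

lemma poly_cheb_T_cos: "poly (map_poly of_rat (cheb_T n)) (cos t) = cos (real n * t)"
proof (induction n rule: cheb_T.induct)
  case (3 n)
  have c: "map_poly (of_rat :: rat \<Rightarrow> real) ([:0, 2:] * p) = [:0, 2:] * map_poly of_rat p" for p
    by (rule poly_eqI) (simp add: coeff_map_poly of_rat_mult coeff_pCons split: nat.split)
  have "cos (real (Suc (Suc n)) * t) + cos (real n * t) = 2 * cos t * cos (real (Suc n) * t)"
    using cos_add[of "real (Suc n) * t" t] cos_diff[of "real (Suc n) * t" t]
    by (simp add: algebra_simps)
  with 3 show ?case
    by (simp only: cheb_T.simps map_poly_of_rat_diff c poly_diff poly_mult) simp
qed (simp_all add: map_poly_pCons)

lemma degree_cheb_T: "degree (cheb_T n :: rat poly) = n"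
proof (induction n rule: less_induct)
  case (less n)
  show ?case
  proof (cases n rule: cheb_T.cases)
    case (3 k)
    have 1: "degree (cheb_T (Suc k) :: rat poly) = Suc k" "degree (cheb_T k :: rat poly) = k"
      using less[of "Suc k"] less[of k] 3 by auto
    hence nz: "cheb_T (Suc k) \<noteq> (0 :: rat poly)" by (metis degree_0 nat.distinct(1))
    have "degree ([:0, 2:] * cheb_T (Suc k) :: rat poly) = Suc (Suc k)"
      using nz 1 by (subst degree_mult_eq) auto
    hence "degree ([:0, 2:] * cheb_T (Suc k) - cheb_T k :: rat poly) = Suc (Suc k)"
      using 1 degree_add_eq_left[of "- cheb_T k" "[:0, 2:] * cheb_T (Suc k) :: rat poly"]
      by simp
    thus ?thesis using 3 by simp
  qed auto
qed

theorem is_min_poly_rat_psi: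
  assumes "m > 0"
  shows "is_min_poly_rat (2 * cos (2 * pi / real m)) (psi m)"
proof -
  define p :: "rat poly" where "p = cheb_T m - 1"
  define q where "q = pcompose p [:0, 1/2:]"
  have "degree p = m"
    using assms degree_add_eq_left[of "-1" "cheb_T m :: rat poly"]
    by (simp add: p_def degree_cheb_T)
  hence "degree q = m" by (simp add: q_def degree_pcompose)
  hence "q \<noteq> 0" using assms by auto
  have eval: "poly (map_poly of_rat (pcompose r [:0, 1/2:])) (2 * x) =
               poly (map_poly of_rat r) x" for r and x :: real
  proof (induction r)
    case (pCons a r)
    have c: "map_poly (of_rat :: rat \<Rightarrow> real) ([:a:] + [:0, 1/2:] * s) =
               [:of_rat a:] + [:0, 1/2:] * map_poly of_rat s" for s
      by (rule poly_eqI)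
         (simp add: coeff_map_poly of_rat_add of_rat_mult of_rat_divide coeff_pCons split: nat.split)
    show ?case using pCons
      by (simp only: pcompose_pCons c poly_add poly_mult) (simp add: map_poly_pCons)
  qed simp
  have "poly (map_poly of_rat p) (cos (2 * pi / real m)) = 0"
    using assms by (simp add: p_def map_poly_of_rat_diff poly_cheb_T_cos)
  hence "poly (map_poly of_rat q) (2 * cos (2 * pi / real m)) = 0"
    by (simp add: q_def eval)
  thus ?thesis
    unfolding psi_def using is_min_poly_rat_min_poly_rat \<open>q \<noteq> 0\<close> by blast
qed

end

(* The roots of U_n are the n numbers cos(2 pi k / (2n+2)) with 1 <= k <= n, those of T_n the n
   numbers cos(2 pi (2i+1) / (4n)) with i < n. With the fraction reduced to a/j, each is half of a
   Galois conjugate of 2 cos(2 pi / j), hence a root of psi_j(2x); this is irreducibility of the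
   cyclotomic polynomials, transferred from z to z + 1/z. Conversely the psi_j are irreducible and
   pairwise distinct, so their product over the occurring j divides the Chebyshev polynomial. It has
   at least n roots, so the two agree up to a constant, which is read off the leading coefficients. *)

theory Submission
  imports Defs "HOL-Number_Theory.Cong"
begin

section \<open>Evaluation of rational and integer polynomials\<close>

lemma map_poly_mult_hom:
  fixes h :: "'a::comm_ring_1 \<Rightarrow> 'b::comm_ring_1"
  assumes h: "h 0 = 0" "\<And>a b. h (a + b) = h a + h b" "\<And>a b. h (a * b) = h a * h b"
  shows "map_poly h (p * q) = map_poly h p * map_poly h q"
proof (rule poly_eqI)
  fix n
  have "h (sum g A) = (\<Sum>i\<in>A. h (g i))" for g :: "nat \<Rightarrow> 'a" and A
    by (induction A rule: infinite_finite_induct) (simp_all add: h)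
  thus "coeff (map_poly h (p * q)) n = coeff (map_poly h p * map_poly h q) n"
    by (simp add: coeff_map_poly coeff_mult h)
qed

definition rpoly :: "rat poly \<Rightarrow> 'a::field_char_0 \<Rightarrow> 'a" where
  "rpoly p x = poly (map_poly of_rat p) x"

lemma rpoly_0 [simp]: "rpoly 0 x = 0"
  and rpoly_pCons [simp]: "rpoly (pCons a p) x = of_rat a + x * rpoly p x"
  by (simp_all add: rpoly_def map_poly_pCons)

lemma rpoly_diff: "rpoly (p - q) x = rpoly p x - rpoly q x"
  by (simp add: rpoly_def map_poly_of_rat_diff)

lemma rpoly_mult: "rpoly (p * q) x = rpoly p x * rpoly q x"
  by (simp add: rpoly_def map_poly_mult_hom of_rat_add of_rat_mult)

lemma rpoly_prod: "rpoly (prod f A) x = (\<Prod>i\<in>A. rpoly (f i) x)"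
  by (induction A rule: infinite_finite_induct) (simp_all add: rpoly_mult one_pCons)

lemma rpoly_add: "rpoly (p + q) x = rpoly p x + rpoly q x"
  using rpoly_diff[of p "- q" x] rpoly_diff[of 0 q x] by simp

lemma rpoly_pcompose: "rpoly (pcompose p q) x = rpoly p (rpoly q x)"
  by (induction p) (simp_all add: pcompose_pCons rpoly_add rpoly_mult)

text \<open>Integer coefficients are what the conjugacy argument below needs, since it reduces them
  modulo a prime.\<close>

definition ipoly :: "int poly \<Rightarrow> 'a::comm_ring_1 \<Rightarrow> 'a" where
  "ipoly p x = poly (map_poly of_int p) x"

lemma ipoly_0 [simp]: "ipoly 0 x = 0"
  and ipoly_pCons [simp]: "ipoly (pCons a p) x = of_int a + x * ipoly p x"
  by (simp_all add: ipoly_def map_poly_pCons)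

lemma ipoly_1 [simp]: "ipoly 1 x = 1"
  by (simp add: one_pCons)

lemma ipoly_diff: "ipoly (p - q) x = ipoly p x - ipoly q x"
proof -
  have "map_poly (of_int :: int \<Rightarrow> 'a) (p - q) = map_poly of_int p - map_poly of_int q"
    by (rule poly_eqI) (simp add: coeff_map_poly)
  thus ?thesis by (simp add: ipoly_def)
qed

lemma ipoly_add: "ipoly (p + q) x = ipoly p x + ipoly q x"
  using ipoly_diff[of p "- q" x] ipoly_diff[of 0 q x] by simp

lemma ipoly_mult: "ipoly (p * q) x = ipoly p x * ipoly q x"
  by (simp add: ipoly_def map_poly_mult_hom)

lemma ipoly_power: "ipoly (p ^ k) x = ipoly p x ^ k"
  by (induction k) (simp_all add: ipoly_mult)

lemma ipoly_smult: "ipoly (smult c p) x = of_int c * ipoly p x"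
  using ipoly_mult[of "[:c:]" p] by simp

lemma ipoly_monom: "ipoly (monom c k) x = of_int c * x ^ k"
  by (simp add: ipoly_def map_poly_monom poly_monom)

lemma ipoly_pcompose: "ipoly (pcompose p q) x = ipoly p (ipoly q x)"
  by (induction p) (simp_all add: pcompose_pCons ipoly_add ipoly_mult)

lemma ipoly_of_real: "ipoly p (of_real x :: complex) = of_real (ipoly p x)"
  by (induction p) simp_all

text \<open>\<open>c\<close> is a common denominator, built up coefficient by coefficient. It does
  not depend on \<open>x\<close>, so \<open>q\<close> and \<open>Q\<close> have the same
  zeros.\<close>

lemma ipoly_clear_denominators:
  fixes q :: "rat poly"
  shows "\<exists>c Q. c \<noteq> 0 \<and> (\<forall>x::'a::field_char_0. ipoly Q x = of_int c * rpoly q x)"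
proof (induction q)
  case 0
  show ?case by (intro exI[of _ 1] exI[of _ 0]) simp
next
  case (pCons a q)
  then obtain c Q where c: "c \<noteq> 0" and Q: "\<And>x::'a. ipoly Q x = of_int c * rpoly q x" by blast
  obtain u v where uv: "a = of_int u / of_int v" "v > 0"
    by (cases a) (simp add: Fract_of_int_quotient)
  hence av: "(of_int u :: 'a) = of_rat a * of_int v" by (simp add: of_rat_divide)
  hence "ipoly (pCons (u * c) (smult v Q)) x = of_int (v * c) * rpoly (pCons a q) x" for x :: 'a
    by (simp add: Q ipoly_smult av algebra_simps)
  with c uv show ?case by (intro exI[of _ "v * c"] exI[of _ "pCons (u * c) (smult v Q)"]) simp
qed

section \<open>Powers modulo a prime\<close>

text \<open>The inner binomial coefficients are multiples of \<open>p\<close>. The general ring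
  covers both integers and integer polynomials.\<close>

lemma prime_power_add_dvd:
  fixes x y :: "'a::comm_ring_1"
  assumes "prime p"
  shows "of_nat p dvd (x + y) ^ p - x ^ p - y ^ p"
proof -
  have p: "p > 0" using assms by (simp add: prime_gt_0_nat)
  have "{..p} = insert 0 (insert p {0<..<p})" using p by auto
  hence "(x + y) ^ p - x ^ p - y ^ p = (\<Sum>k\<in>{0<..<p}. of_nat (p choose k) * x ^ k * y ^ (p - k))"
    using p by (simp add: binomial_ring)
  also have "of_nat p dvd \<dots>"
  proof (intro dvd_sum dvd_mult2)
    fix k assume "k \<in> {0<..<p}"
    hence "p dvd (p choose k)" using assms p by (intro dvd_choose_prime) auto
    thus "(of_nat p :: 'a) dvd of_nat (p choose k)" by (metis dvd_def of_nat_mult)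
  qed
  finally show ?thesis .
qed

lemma fermat_int:
  fixes a :: int
  assumes p: "prime p"
  shows "[a ^ p = a] (mod int p)"
proof -
  \<comment> \<open>A nonnegative representative of \<open>a\<close>, so that induction on naturals
    applies.\<close>
  define b where "b = nat (a mod int p)"
  have "p > 0" using p by (simp add: prime_gt_0_nat)
  hence ab: "[a = int b] (mod int p)" by (simp add: b_def cong_def)
  have "int p dvd int b ^ p - int b"
  proof (induction b)
    case 0
    show ?case using \<open>p > 0\<close> by (simp add: zero_power)
  next
    case (Suc b)
    have "int p dvd (int b + 1) ^ p - int b ^ p - 1 ^ p"
      using prime_power_add_dvd[OF p, of "int b" 1] by simp
    from dvd_add[OF this Suc] show ?case by (simp add: algebra_simps)
  qed
  hence "[int b ^ p = int b] (mod int p)" by (simp add: cong_iff_dvd_diff)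
  thus ?thesis by (meson ab cong_pow cong_sym cong_trans)
qed

text \<open>This is the Frobenius map: modulo \<open>p\<close>, taking \<open>p\<close>-th powers is
  additive and, by Fermat, fixes the coefficients.\<close>

lemma pcompose_monom_prime_dvd:
  fixes f :: "int poly"
  assumes p: "prime p"
  shows "of_nat p dvd f ^ p - pcompose f (monom 1 p)"
proof (induction f)
  case 0
  show ?case using p by (simp add: prime_gt_0_nat zero_power)
next
  case (pCons a f)
  let ?x = "[:0, 1:] :: int poly"
  have d1: "of_nat p dvd ([:a:] + ?x * f) ^ p - [:a:] ^ p - (?x * f) ^ p"
    by (rule prime_power_add_dvd[OF p])
  have d2: "of_nat p dvd [:a ^ p - a:]"
  proof -
    have "int p dvd a ^ p - a"
      using fermat_int[OF p, of a] by (simp add: cong_iff_dvd_diff)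
    thus ?thesis by (simp add: of_nat_poly)
  qed
  have d3: "of_nat p dvd ?x ^ p * (f ^ p - pcompose f (monom 1 p))"
    using pCons by simp
  \<comment> \<open>The three summands are the additivity defect, the Fermat defect of the constant
    term, and the shifted induction hypothesis.\<close>
  have eq: "pCons a f ^ p - pcompose (pCons a f) (monom 1 p) =
     (([:a:] + ?x * f) ^ p - [:a:] ^ p - (?x * f) ^ p) + [:a ^ p - a:] +
     ?x ^ p * (f ^ p - pcompose f (monom 1 p))"
  proof -
    have "[:a:] ^ p = [:a ^ p:]" by (metis poly_const_pow)
    moreover have "monom 1 p = ?x ^ p" by (simp add: monom_altdef)
    moreover have "[:a ^ p - a:] = [:a ^ p:] - [:a:]" by simp
    moreover have "pCons a f ^ p = ([:a:] + ?x * f) ^ p" by simp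
    ultimately show ?thesis
      by (simp only: pcompose_pCons power_mult_distrib) (simp only: algebra_simps)
  qed
  show ?case
    unfolding eq by (intro dvd_add d1 d2 d3)
qed

section \<open>Conjugates of roots of unity\<close>

text \<open>A form of Gauss's lemma: the pseudo-remainder of \<open>r\<close> by \<open>f\<close>
  vanishes at \<open>z\<close>, hence is 0 by minimality, and because \<open>f\<close> has content 1
  the scaling factor \<open>a\<close> divides the quotient and cancels.\<close>

lemma primitive_min_poly_exists:
  fixes z :: "'a::field_char_0"
  assumes "q \<noteq> 0" "ipoly q z = 0"
  obtains f where "ipoly f z = 0" "f \<noteq> 0"
    "\<And>r. ipoly r z = 0 \<Longrightarrow> r \<noteq> 0 \<Longrightarrow> degree f \<le> degree r"
    "\<And>r. ipoly r z = 0 \<Longrightarrow> f dvd r"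
proof -
  let ?P = "\<lambda>q. q \<noteq> 0 \<and> ipoly q z = 0"
  obtain f0 where f0: "?P f0" and min: "\<And>q. ?P q \<Longrightarrow> degree f0 \<le> degree q"
    using arg_min_nat_lemma[of ?P q degree] assms by blast
  define f where "f = primitive_part f0"
  have cf: "content f = 1" and f: "f \<noteq> 0" and deg: "degree f = degree f0"
    using f0 by (auto simp: f_def)
  have "ipoly f0 z = of_int (content f0) * ipoly f z"
    by (metis content_times_primitive_part f_def ipoly_smult)
  with f0 have fz: "ipoly f z = 0" by auto
  have dvd: "f dvd r" if r: "ipoly r z = 0" for r
  proof -
    obtain a s where a: "a \<noteq> 0" "smult a r = f * s + pseudo_mod r f"
      using pseudo_mod(1)[OF f] by blast
    have "ipoly (pseudo_mod r f) z = 0"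
      using arg_cong[OF a(2), of "\<lambda>p. ipoly p z"] r fz by (simp add: ipoly_smult ipoly_add ipoly_mult)
    hence "pseudo_mod r f = 0"
      using pseudo_mod(2)[OF f, of r] min[of "pseudo_mod r f"] deg by linarith
    hence eq: "smult a r = f * s" using a by simp
    hence "f * s = [:a:] * r" by simp
    hence "[:a:] dvd f * s" by (rule dvdI)
    hence "[:a:] dvd s"
      using cf by (simp add: const_poly_dvd_iff_dvd_content content_mult)
    then obtain s' where "s = [:a:] * s'" by blast
    hence "smult a r = smult a (f * s')" using eq by simp
    with a have "r = f * s'" using smult_cancel by blast
    thus ?thesis by simp
  qed
  show ?thesis
    by (rule that[OF fz f]) (simp_all add: deg min dvd)
qed

text \<open>If \<open>f\<close> is a primitive polynomial of least degree vanishing at \<open>z\<close> and \<open>x\<^sup>m - 1 = f g\<close>, then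
  \<open>f(z\<^sup>p) \<noteq> 0\<close> would force \<open>g(z\<^sup>p) = 0\<close>, so that differentiating at \<open>z\<^sup>p\<close> gives
  \<open>m z^(p (m - 1)) = f(z\<^sup>p) g'(z\<^sup>p)\<close>. Since \<open>f(x\<^sup>p) \<equiv> f(x)\<^sup>p\<close> modulo \<open>p\<close>, the right-hand side lies in
  \<open>p \<int>[z]\<close>; reducing modulo \<open>f\<close>, whose leading coefficient is a unit, yields \<open>p dvd m\<close>.\<close>

lemma root_of_unity_conjugate_prime:
  fixes z :: "'a::field_char_0"
  assumes m: "m > 0" "z ^ m = 1" and p: "prime p" "\<not> p dvd m" and q: "ipoly q z = 0"
  shows "ipoly q (z ^ p) = 0"
proof -
  define F :: "int poly" where "F = monom 1 m - 1"
  have F: "ipoly F w = w ^ m - 1" for w :: 'a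
    by (simp add: F_def ipoly_diff ipoly_monom)
  have "coeff F m = 1" using m by (simp add: F_def)
  hence "F \<noteq> 0" by auto
  moreover have "ipoly F z = 0" using m by (simp add: F)
  ultimately obtain f where f: "ipoly f z = 0" "f \<noteq> 0"
    and min: "\<And>r. ipoly r z = 0 \<Longrightarrow> r \<noteq> 0 \<Longrightarrow> degree f \<le> degree r"
    and dvd: "\<And>r. ipoly r z = 0 \<Longrightarrow> f dvd r"
    by (rule primitive_min_poly_exists) (rule that; assumption)
  obtain g where g: "F = f * g" using dvd[OF \<open>ipoly F z = 0\<close>] by blast
  have "degree F = m"
    unfolding F_def using m degree_add_eq_left[of "-1" "monom 1 m :: int poly"]
    by (simp add: degree_monom_eq)
  with \<open>coeff F m = 1\<close> have "lead_coeff f * lead_coeff g = 1"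
    by (metis g lead_coeff_mult)
  hence unit: "lead_coeff f dvd 1" by (metis dvd_triv_left)
  have "ipoly f (z ^ p) = 0"
  proof (rule ccontr)
    assume nz: "ipoly f (z ^ p) \<noteq> 0"
    have zpm: "(z ^ p) ^ m = 1" using m by (metis power_mult mult.commute power_one)
    hence gz: "ipoly g (z ^ p) = 0"
      using nz F[of "z ^ p"] by (simp add: g ipoly_mult)
    have "pderiv F = monom (int m) (m - 1)"
      by (simp add: F_def pderiv_diff pderiv_monom)
    hence "of_nat m * (z ^ p) ^ (m - 1) = ipoly (f * pderiv g + g * pderiv f) (z ^ p)"
      by (simp add: ipoly_monom flip: pderiv_mult g)
    also have "\<dots> = ipoly f (z ^ p) * ipoly (pderiv g) (z ^ p)"
      by (simp add: ipoly_add ipoly_mult gz)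
    finally have der: "of_nat m * (z ^ p) ^ (m - 1) = ipoly f (z ^ p) * ipoly (pderiv g) (z ^ p)" .
    obtain h where h: "f ^ p - pcompose f (monom 1 p) = of_nat p * h"
      using pcompose_monom_prime_dvd[OF p(1), of f] by blast
    have fz: "ipoly f (z ^ p) = - of_nat p * ipoly h z"
    proof -
      have "p > 0" using p by (simp add: prime_gt_0_nat)
      hence "ipoly (f ^ p - pcompose f (monom 1 p)) z = - ipoly f (z ^ p)"
        using f by (simp add: ipoly_diff ipoly_power ipoly_pcompose ipoly_monom)
      moreover have "ipoly (of_nat p * h) z = of_nat p * ipoly h z"
        by (simp add: of_nat_poly ipoly_mult ipoly_smult)
      ultimately have "- ipoly f (z ^ p) = of_nat p * ipoly h z" by (simp only: h)
      thus ?thesis by (simp add: minus_equation_iff eq_commute)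
    qed
    \<comment> \<open>Chosen so that \<open>of_nat m = of_nat p * ipoly k z\<close>: the factor
      \<open>monom 1 p\<close> completes \<open>(z ^ p) ^ (m - 1)\<close> to
      \<open>(z ^ p) ^ m = 1\<close>, and the sign comes from \<open>fz\<close>.\<close>
    define k where "k = - (monom 1 p * h * pcompose (pderiv g) (monom 1 p))"
    have k: "ipoly k z = - (z ^ p * ipoly h z * ipoly (pderiv g) (z ^ p))"
      using ipoly_diff[of 0 "monom 1 p * h * pcompose (pderiv g) (monom 1 p)" z]
      by (simp add: k_def ipoly_mult ipoly_monom ipoly_pcompose)
    have "of_nat m = of_nat m * ((z ^ p) ^ (m - 1) * z ^ p)"
      using zpm m by (metis mult.right_neutral power_minus_mult)
    also have "\<dots> = ipoly f (z ^ p) * ipoly (pderiv g) (z ^ p) * z ^ p"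
      using der by (simp add: mult.assoc)
    also have "\<dots> = of_nat p * ipoly k z"
      by (simp add: fz k)
    finally have mk: "of_nat m = of_nat p * ipoly k z" .
    obtain s r where sr: "pseudo_divmod k f = (s, r)" by fastforce
    \<comment> \<open>The factor by which pseudo-division scales \<open>k\<close>; being a unit, it
      does not affect divisibility by \<open>p\<close>.\<close>
    define u where "u = lead_coeff f ^ (Suc (degree k) - degree f)"
    have u: "u dvd 1" using unit by (simp add: u_def power_abs)
    have kr: "smult u k = f * s + r" "r = 0 \<or> degree r < degree f"
      using pseudo_divmod[OF f(2) sr] by (auto simp: u_def)
    have "of_int u * ipoly k z = ipoly r z"
      using arg_cong[OF kr(1), of "\<lambda>p. ipoly p z"] f
      by (simp add: ipoly_smult ipoly_add ipoly_mult)
    \<comment> \<open>Vanishes at \<open>z\<close> but has smaller degree than \<open>f\<close>, so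
      it is 0; its constant coefficient then shows that \<open>p\<close> divides
      \<open>u * m\<close>.\<close>
    define t where "t = [:u * int m:] - smult (int p) r"
    have "ipoly t z = 0"
      using mk \<open>of_int u * ipoly k z = ipoly r z\<close>[symmetric]
      by (simp add: t_def ipoly_diff ipoly_smult)
    moreover have "degree f > 0"
    proof (rule ccontr)
      assume "\<not> ?thesis"
      then obtain c where "f = [:c:]" using degree_eq_zeroE by auto
      with f show False by simp
    qed
    have "degree t < degree f"
      unfolding t_def using kr(2) \<open>degree f > 0\<close>
      by (intro degree_diff_less) auto
    ultimately have "t = 0" using min[of t] by fastforce
    hence "coeff t 0 = 0" by simp
    hence "u * int m = int p * coeff r 0" by (simp add: t_def)
    hence "int p dvd u * int m" by simp
    hence "int p dvd int m" using u
      by (metis dvd_mult_unit_iff mult.commute)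
    with p show False by simp
  qed
  thus ?thesis using dvd[OF q] by (auto simp: ipoly_mult)
qed

text \<open>Split off one prime factor of \<open>a\<close> at a time. The prime case applies again
  because every power of \<open>z\<close> is still an \<open>m\<close>-th root of unity.\<close>

lemma root_of_unity_conjugate:
  fixes z :: "'a::field_char_0"
  assumes m: "m > 0" "z ^ m = 1" and q: "ipoly q z = 0" and "coprime a m"
  shows "ipoly q (z ^ a) = 0"
  using \<open>coprime a m\<close>
proof (induction a rule: less_induct)
  case (less a)
  consider "a = 0" | "a = 1" | "a > 1" by linarith
  thus ?case
  proof cases
    \<comment> \<open>Coprimality of 0 and \<open>m\<close> forces \<open>m = 1\<close>, hence
      \<open>z = 1\<close>.\<close>
    case 1
    thus ?thesis using less.prems m q by simp
  next
    case 2
    thus ?thesis using q by simp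
  next
    case 3
    then obtain p where p: "prime p" "p dvd a" using prime_factor_nat[of a] by auto
    then obtain b where b: "a = p * b" by blast
    have "b < a" using b 3 p prime_gt_1_nat[of p] by (cases "b = 0") auto
    moreover have "coprime b m" "coprime p m" using less.prems b by auto
    ultimately have "ipoly q (z ^ b) = 0" using less.IH by blast
    moreover have "\<not> p dvd m" using \<open>coprime p m\<close> p
      by (metis coprime_absorb_left not_prime_unit)
    moreover have "(z ^ b) ^ m = 1" using m by (metis power_mult mult.commute power_one)
    ultimately have "ipoly q ((z ^ b) ^ p) = 0"
      using root_of_unity_conjugate_prime[of m "z ^ b" p q] m p by blast
    thus ?thesis by (simp add: b power_mult[symmetric] mult.commute)
  qed
qed

section \<open>Transfer from roots of unity to cosines\<close>

lemma ipoly_joukowski_lift: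
  fixes Q :: "int poly"
  shows "\<exists>R d. \<forall>z::complex. z \<noteq> 0 \<longrightarrow> ipoly R z = z ^ d * ipoly Q (z + 1 / z)"
proof (induction Q)
  case 0
  show ?case by (rule exI[of _ 0]) simp
next
  case (pCons a Q)
  then obtain R d where R: "\<And>z::complex. z \<noteq> 0 \<Longrightarrow> ipoly R z = z ^ d * ipoly Q (z + 1 / z)" by blast
  show ?case
    \<comment> \<open>A Horner step costs one more power of \<open>z\<close>, and
      \<open>z * (z + 1 / z) = 1 + z ^ 2\<close>.\<close>
    by (rule exI[of _ "monom a (Suc d) + [:1, 0, 1:] * R"], rule exI[of _ "Suc d"])
       (auto simp: ipoly_add ipoly_mult ipoly_monom R field_simps)
qed

text \<open>On the unit circle \<open>z + 1 / z\<close> is twice the cosine of the angle. The root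
  of \<open>q\<close> thus lifts to a root of unity killed by an integer polynomial, moves to its
  \<open>a\<close>-th power, and descends again.\<close>

lemma cos_conjugate:
  fixes q :: "rat poly"
  assumes m: "m > 0" and q: "rpoly q (2 * cos (2 * pi / real m)) = 0" and a: "coprime a m"
  shows "rpoly q (2 * cos (2 * pi * real a / real m)) = 0"
proof -
  obtain c Q where c: "c \<noteq> 0" and Q: "\<And>x::real. ipoly Q x = of_int c * rpoly q x"
    using ipoly_clear_denominators[of q] by blast
  obtain R d where R: "\<And>z::complex. z \<noteq> 0 \<Longrightarrow> ipoly R z = z ^ d * ipoly Q (z + 1 / z)"
    using ipoly_joukowski_lift by blast
  have cis: "ipoly R (cis t) = cis t ^ d * of_real (ipoly Q (2 * cos t))" for t
  proof -
    have "cis t + 1 / cis t = of_real (2 * cos t)"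
      by (simp add: complex_eq_iff flip: cis_inverse inverse_eq_divide)
    thus ?thesis by (simp only: R cis_neq_zero ipoly_of_real not_False_eq_True)
  qed
  define z where "z = cis (2 * pi / real m)"
  have "ipoly R z = 0" using q by (simp add: z_def cis Q)
  moreover have "z ^ m = 1" using m by (simp add: z_def DeMoivre)
  ultimately have "ipoly R (z ^ a) = 0" using root_of_unity_conjugate m a by blast
  hence "ipoly R (cis (2 * pi * real a / real m)) = 0"
    by (simp add: z_def DeMoivre algebra_simps)
  thus ?thesis using c by (simp add: cis Q)
qed

section \<open>Divisibility, irreducibility and distinctness of the \<open>psi m\<close>\<close>

lemma psi_monic: "m > 0 \<Longrightarrow> lead_coeff (psi m) = 1"
  and psi_root: "m > 0 \<Longrightarrow> rpoly (psi m) (2 * cos (2 * pi / real m)) = 0"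
  and psi_minimal: "m > 0 \<Longrightarrow> q \<noteq> 0 \<Longrightarrow> rpoly q (2 * cos (2 * pi / real m)) = 0 \<Longrightarrow>
    degree (psi m) \<le> degree q"
  using is_min_poly_rat_psi[of m] by (auto simp: is_min_poly_rat_def rpoly_def)

lemma psi_nonzero: "m > 0 \<Longrightarrow> psi m \<noteq> 0"
  using psi_monic[of m] by auto

lemma psi_dvd:
  assumes m: "m > 0" and q: "rpoly q (2 * cos (2 * pi / real m)) = 0"
  shows "psi m dvd q"
proof -
  have "rpoly (psi m * (q div psi m) + q mod psi m) (2 * cos (2 * pi / real m)) = 0"
    using q by simp
  hence "rpoly (q mod psi m) (2 * cos (2 * pi / real m)) = 0"
    by (simp only: rpoly_add rpoly_mult psi_root[OF m])
  hence "q mod psi m = 0"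
    using psi_minimal[OF m, of "q mod psi m"] degree_mod_less[OF psi_nonzero[OF m], of q] by linarith
  thus ?thesis by (simp add: dvd_eq_mod_eq_0)
qed

text \<open>\<open>psi i\<close> divides \<open>T_i(x/2) - 1\<close>, whose value at
  \<open>2 * cos t\<close> is \<open>cos (i * t) - 1\<close>. At \<open>t = 2 * pi / j\<close> this
  vanishes only if \<open>i / j\<close> is an integer.\<close>

lemma psi_root_imp_dvd:
  assumes i: "i > 0" and j: "j > 0" and root: "rpoly (psi i) (2 * cos (2 * pi / real j)) = 0"
  shows "j dvd i"
proof -
  let ?q = "pcompose (cheb_T i - 1) [:0, 1/2:] :: rat poly"
  have q: "rpoly ?q (2 * cos t) = cos (real i * t) - 1" for t :: real
    by (simp add: rpoly_pcompose rpoly_diff one_pCons of_rat_divide)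
       (simp add: rpoly_def poly_cheb_T_cos)
  have "psi i dvd ?q" using i by (intro psi_dvd) (simp_all add: q)
  hence "rpoly ?q (2 * cos (2 * pi / real j)) = 0"
    using root by (auto simp: rpoly_mult elim!: dvdE)
  hence "cos (real i * (2 * pi / real j)) = 1" by (simp add: q)
  then obtain k :: int where "real i * (2 * pi / real j) = of_int k * 2 * pi"
    using cos_one_2pi_int by blast
  hence "real i = of_int k * real j" using j by (simp add: field_simps)
  hence "of_int (int i) = (of_int (k * int j) :: real)" by simp
  hence "int i = k * int j" by (simp only: of_int_eq_iff)
  hence "int j dvd int i" by simp
  thus ?thesis by simp
qed

text \<open>Irreducibility: the defining root kills \<open>c\<close> or its cofactor, and
  \<open>psi m\<close> divides whichever vanishes there.\<close>

lemma dvd_psi_cases: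
  assumes m: "m > 0" and c: "c dvd psi m"
  shows "c dvd 1 \<or> psi m dvd c"
proof -
  obtain e where e: "psi m = c * e" using c by blast
  hence "rpoly c (2 * cos (2 * pi / real m)) = 0 \<or> rpoly e (2 * cos (2 * pi / real m)) = 0"
    using psi_root[OF m] by (simp add: rpoly_mult)
  thus ?thesis
  proof
    assume "rpoly e (2 * cos (2 * pi / real m)) = 0"
    then obtain d where "e = psi m * d" using psi_dvd[OF m] by blast
    with e have "psi m * (c * d) = psi m * 1" by (simp add: algebra_simps)
    hence "c * d = 1" using psi_nonzero[OF m] by (simp only: mult_cancel_left) simp
    thus ?thesis by (metis dvd_triv_left)
  qed (use psi_dvd[OF m] in blast)
qed

text \<open>By irreducibility a common root makes \<open>psi i\<close> and \<open>psi j\<close>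
  divide each other, so \<open>i\<close> and \<open>j\<close> divide each other.\<close>

lemma psi_root_imp_eq:
  assumes i: "i > 0" and j: "j > 0" and root: "rpoly (psi j) (2 * cos (2 * pi / real i)) = 0"
  shows "i = j"
proof -
  have "psi i dvd psi j" by (rule psi_dvd[OF i root])
  moreover have "\<not> psi i dvd 1"
  proof
    assume "psi i dvd 1"
    then obtain d where "1 = psi i * d" by blast
    hence "rpoly 1 (2 * cos (2 * pi / real i)) = rpoly (psi i * d) (2 * cos (2 * pi / real i))" by simp
    thus False using psi_root[OF i] by (simp add: rpoly_mult one_pCons)
  qed
  ultimately have "psi j dvd psi i" using dvd_psi_cases[OF j] by blast
  then obtain d where "psi i = psi j * d" by blast
  hence "rpoly (psi i) (2 * cos (2 * pi / real j)) = 0" using psi_root[OF j] by (simp add: rpoly_mult)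
  with assms show ?thesis by (intro dvd_antisym psi_root_imp_dvd)
qed

text \<open>The product over the other indices does not vanish at the root of \<open>psi i\<close>,
  so the cofactor does. Excluding 0 matters for distinctness: since \<open>2 * pi / 0 = 0\<close> in
  HOL, \<open>psi 0\<close> equals \<open>psi 1\<close>.\<close>

lemma prod_psi_dvd:
  assumes "finite J" "0 \<notin> J" "\<And>j. j \<in> J \<Longrightarrow> psi j dvd q"
  shows "(\<Prod>j\<in>J. psi j) dvd q"
  using assms
proof (induction J)
  case (insert i J)
  have pos: "j > 0" if "j \<in> insert i J" for j
    using that insert.prems(1) by (cases j) auto
  obtain e where e: "q = (\<Prod>j\<in>J. psi j) * e" using insert by auto
  have "psi i dvd q" using insert.prems by blast
  then obtain d where "q = psi i * d" by blast
  hence "rpoly q (2 * cos (2 * pi / real i)) = 0" using psi_root[of i] pos by (simp add: rpoly_mult)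
  moreover have "rpoly (\<Prod>j\<in>J. psi j) (2 * cos (2 * pi / real i)) \<noteq> 0"
    using psi_root_imp_eq[of i] pos insert.hyps by (auto simp: rpoly_prod)
  ultimately have "rpoly e (2 * cos (2 * pi / real i)) = 0" by (simp add: e rpoly_mult)
  hence "psi i dvd e" using pos by (intro psi_dvd) simp_all
  thus ?case using insert.hyps e by (simp add: mult.commute mult_dvd_mono)
qed simp

section \<open>A criterion for being a product of \<open>psi j (2x)\<close>\<close>

text \<open>Shared by both kinds: \<open>root\<close> makes the product divide \<open>P\<close>,
  while \<open>S\<close> supplies \<open>n\<close> distinct roots of the product, so the cofactor is
  constant.\<close>

lemma eq_prod_psi:
  fixes P :: "rat poly" and J :: "nat set" and S :: "real set"
  assumes J: "finite J" "0 \<notin> J"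
    and P: "degree P = n" "lead_coeff P = c * 2 ^ n" "c \<noteq> 0"
    and root: "\<And>j. j \<in> J \<Longrightarrow> rpoly P (cos (2 * pi / real j)) = 0"
    and S: "card S = n" "\<And>x. x \<in> S \<Longrightarrow> \<exists>j\<in>J. \<exists>a. coprime a j \<and> x = cos (2 * pi * real a / real j)"
  shows "P = smult c (\<Prod>j\<in>J. pcompose (psi j) [:0, 2:])"
proof -
  define Q where "Q = (\<Prod>j\<in>J. psi j)"
  define R where "R = pcompose Q [:0, 2:]"
  have R_prod: "R = (\<Prod>j\<in>J. pcompose (psi j) [:0, 2:])"
    by (simp add: R_def Q_def pcompose_prod)
  have pos: "j > 0" if "j \<in> J" for j using that J by (auto intro: gr0I)
  have "P \<noteq> 0" using P by auto
  \<comment> \<open>The \<open>psi j\<close> have roots at twice the cosines, so divisibility is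
    shown for \<open>P(x/2)\<close> and then rescaled by \<open>x -> 2x\<close>.\<close>
  have "Q dvd pcompose P [:0, 1/2:]"
    unfolding Q_def
    by (intro prod_psi_dvd J psi_dvd) (auto simp: pos rpoly_pcompose of_rat_divide root)
  then obtain E where "pcompose P [:0, 1/2:] = Q * E" by blast
  hence "pcompose (pcompose P [:0, 1/2:]) [:0, 2:] = R * pcompose E [:0, 2:]"
    by (simp add: R_def pcompose_mult)
  also have "pcompose (pcompose P [:0, 1/2:]) [:0, 2:] = P"
    by (simp add: pcompose_pCons flip: pcompose_assoc)
  finally obtain e where e: "P = R * e" by blast
  with \<open>P \<noteq> 0\<close> have "R \<noteq> 0" "e \<noteq> 0" by auto
  have "lead_coeff Q = 1"
    unfolding Q_def lead_coeff_prod by (intro prod.neutral ballI psi_monic pos)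
  hence lcR: "lead_coeff R = 2 ^ degree R"
    unfolding R_def by (subst lead_coeff_comp) (simp_all add: degree_pcompose)
  \<comment> \<open>The roots in \<open>S\<close> are real, so they are counted over the
    reals.\<close>
  let ?R = "map_poly of_rat R :: real poly"
  have degR: "degree ?R = degree R" by (intro degree_map_poly) simp
  have "?R \<noteq> 0" using \<open>R \<noteq> 0\<close> by (simp add: map_poly_eq_0_iff)
  have "S \<subseteq> {x. poly ?R x = 0}"
  proof
    fix x assume "x \<in> S"
    then obtain j a where j: "j \<in> J" and a: "coprime a j" and x: "x = cos (2 * pi * real a / real j)"
      using S by blast
    have "rpoly (psi j) (2 * x) = 0"
      unfolding x using pos[OF j] by (intro cos_conjugate psi_root a)
    hence "rpoly R x = 0"
      using j J by (auto simp: R_prod rpoly_prod rpoly_pcompose mult.commute prod_zero_iff)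
    thus "x \<in> {x. poly ?R x = 0}" by (simp add: rpoly_def)
  qed
  hence "n \<le> card {x. poly ?R x = 0}"
    using S(1) \<open>?R \<noteq> 0\<close> by (metis card_mono poly_roots_finite)
  also have "\<dots> \<le> degree R" using card_poly_roots_bound[OF \<open>?R \<noteq> 0\<close>] degR by simp
  finally have "n \<le> degree R" .
  moreover have "n = degree R + degree e"
    using P(1) \<open>R \<noteq> 0\<close> \<open>e \<noteq> 0\<close> by (simp add: e degree_mult_eq)
  ultimately have deg: "degree R = n" "degree e = 0" by auto
  then obtain d where d: "e = [:d:]" using degree_eq_zeroE by blast
  have "lead_coeff P = lead_coeff R * d" by (simp add: e d lead_coeff_mult)
  hence "d = c" using P lcR deg by simp
  with e d have "P = smult c R" by simp
  thus ?thesis by (simp only: R_prod)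
qed

section \<open>Leading coefficients and trigonometric values of \<open>cheb_T\<close> and
  \<open>cheb_U\<close>\<close>

lemma coeff_cheb_U:
  "(\<forall>k>n. coeff (cheb_U n :: rat poly) k = 0) \<and> coeff (cheb_U n :: rat poly) n = 2 ^ n"
proof (induction n rule: cheb_U.induct)
  case (3 n)
  have "coeff (cheb_U (Suc (Suc n)) :: rat poly) (Suc k) =
        2 * coeff (cheb_U (Suc n)) k - coeff (cheb_U n) (Suc k)" for k
    by simp
  with 3 show ?case by (auto simp del: cheb_U.simps simp: gr0_conv_Suc elim!: less_natE)
qed (auto simp: coeff_pCons split: nat.splits)

lemma degree_cheb_U: "degree (cheb_U n :: rat poly) = n"
  using coeff_cheb_U[of n]
  by (intro antisym degree_le le_degree) auto

text \<open>Written in the shape \<open>c * 2 ^ n\<close> that \<open>eq_prod_psi\<close> expects.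
  It fails for \<open>n = 0\<close>, where the coefficient is 1.\<close>

lemma coeff_cheb_T:
  assumes "n \<ge> 1"
  shows "coeff (cheb_T n :: rat poly) n = 1 / 2 * 2 ^ n"
  using assms
proof (induction n rule: cheb_T.induct)
  case (3 n)
  have "coeff (cheb_T (Suc (Suc n)) :: rat poly) (Suc (Suc n)) =
        2 * coeff (cheb_T (Suc n)) (Suc n) - coeff (cheb_T n) (Suc (Suc n))"
    by simp
  also have "coeff (cheb_T n :: rat poly) (Suc (Suc n)) = 0"
    by (rule coeff_eq_0) (simp add: degree_cheb_T)
  finally show ?case using 3 by simp
qed auto

lemma rpoly_cheb_T_cos: "rpoly (cheb_T n) (cos t) = cos (real n * t)"
  by (simp add: rpoly_def poly_cheb_T_cos)

text \<open>The product form avoids dividing by \<open>sin t\<close>, which may be 0.\<close>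

lemma rpoly_cheb_U_cos: "sin t * rpoly (cheb_U n) (cos t) = sin (real (n + 1) * t)"
proof (induction n rule: cheb_U.induct)
  case (3 n)
  have "sin (real (n + 3) * t) + sin (real (n + 1) * t) = 2 * cos t * sin (real (n + 2) * t)"
    using sin_add[of "real (n + 2) * t" t] sin_diff[of "real (n + 2) * t" t]
    by (simp add: algebra_simps)
  moreover have "sin t * rpoly (cheb_U (Suc (Suc n))) (cos t) =
     2 * cos t * (sin t * rpoly (cheb_U (Suc n)) (cos t)) - sin t * rpoly (cheb_U n) (cos t)"
    by (simp only: cheb_U.simps rpoly_diff rpoly_mult) (simp add: algebra_simps)
  ultimately show ?case using 3 by (simp add: algebra_simps)
qed (simp_all add: one_pCons sin_double)

section \<open>The two factorizations\<close>

lemma cheb_U_eq_prod_psi: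
  "cheb_U n = (\<Prod>j | j dvd 2 * n + 2 \<and> j \<noteq> 1 \<and> j \<noteq> 2. pcompose (psi j) [:0, 2:])"
proof -
  let ?J = "{j. j dvd 2 * n + 2 \<and> j \<noteq> 1 \<and> j \<noteq> 2}"
  let ?x = "\<lambda>k. cos (2 * pi * real k / real (2 * n + 2))"
  have "cheb_U n = smult 1 (\<Prod>j\<in>?J. pcompose (psi j) [:0, 2:])"
  proof (rule eq_prod_psi[where n = n and S = "?x ` {1..n}"])
    show "finite ?J" by (rule finite_subset[of _ "{..2 * n + 2}"]) (auto dest: dvd_imp_le)
    show "0 \<notin> ?J" by simp
    show "rpoly (cheb_U n) (cos (2 * pi / real j)) = 0" if "j \<in> ?J" for j
    proof -
      from that obtain d where d: "2 * n + 2 = j * d" by blast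
      have "j \<noteq> 0" using d by (cases j) auto
      with that have "j \<ge> 3" by auto
      \<comment> \<open>Here 1 and 2 must be excluded: only for \<open>j \<ge> 3\<close> is the
        angle strictly between 0 and \<open>pi\<close>, so that the sine can be cancelled.\<close>
      hence "sin (2 * pi / real j) > 0" by (intro sin_gt_zero) (auto simp: field_simps)
      moreover have "real (n + 1) * (2 * pi / real j) = real d * pi"
      proof -
        have "2 * real (n + 1) = real j * real d" using arg_cong[OF d, of real] by simp
        thus ?thesis using \<open>j \<noteq> 0\<close> by (simp add: field_simps)
      qed
      hence "sin (2 * pi / real j) * rpoly (cheb_U n) (cos (2 * pi / real j)) = 0"
        by (simp only: rpoly_cheb_U_cos sin_npi)
      ultimately show ?thesis by simp
    qed
    have "inj_on ?x {1..n}"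
    proof (rule inj_onI)
      fix k l assume kl: "k \<in> {1..n}" "l \<in> {1..n}" "?x k = ?x l"
      have rng: "0 \<le> 2 * pi * real k / real (2 * n + 2)" "2 * pi * real k / real (2 * n + 2) \<le> pi"
        if "k \<in> {1..n}" for k
      proof -
        have "2 * real k / real (2 * n + 2) \<le> 1" using that by simp
        from mult_left_mono[OF this, of pi]
        show "2 * pi * real k / real (2 * n + 2) \<le> pi" by (simp add: mult_ac)
      qed simp
      have "2 * pi * real k / real (2 * n + 2) = 2 * pi * real l / real (2 * n + 2)"
        by (rule cos_inj_pi[OF rng[OF kl(1)] rng[OF kl(2)] kl(3)])
      thus "k = l" by simp
    qed
    thus "card (?x ` {1..n}) = n" by (simp add: card_image)
    show "\<exists>j\<in>?J. \<exists>a. coprime a j \<and> x = cos (2 * pi * real a / real j)" if "x \<in> ?x ` {1..n}" for x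
    proof -
      from that obtain k where k: "1 \<le> k" "k \<le> n" and x: "x = ?x k" by auto
      define g where "g = gcd k (2 * n + 2)"
      have "g \<noteq> 0" using k by (simp add: g_def)
      obtain a j where aj: "k = a * g" "2 * n + 2 = j * g" "coprime a j"
        using gcd_coprime_exists[of k "2 * n + 2"] \<open>g \<noteq> 0\<close> unfolding g_def by blast
      \<comment> \<open>This is \<open>2 * k < 2 * n + 2\<close>; in lowest terms
        \<open>0 < a / j < 1 / 2\<close>, which rules out the denominators 1 and 2.\<close>
      have "2 * a * g < j * g" using aj(1,2) k by linarith
      hence "2 * a < j" by simp
      moreover have "a \<noteq> 0" using aj(1) k by (intro notI) simp
      ultimately have "j \<noteq> 1" "j \<noteq> 2" by simp_all
      moreover have "j dvd 2 * n + 2" using aj by simp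
      moreover have "real k / real (2 * n + 2) = real a / real j"
        unfolding aj using \<open>g \<noteq> 0\<close> by simp
      hence "x = cos (2 * pi * real a / real j)" by (simp only: x flip: times_divide_eq_right)
      ultimately show ?thesis using aj(3) by blast
    qed
  qed (use coeff_cheb_U[of n] in \<open>simp_all add: degree_cheb_U\<close>)
  thus ?thesis by simp
qed

text \<open>Since \<open>4 * n = r * N\<close> and \<open>2 * i + 1\<close> is odd, reducing the
  fraction cancels only factors of \<open>N\<close>; the denominators are therefore
  \<open>r * j\<close> with \<open>j\<close> dividing \<open>N\<close>.\<close>

lemma cheb_T_eq_prod_psi:
  assumes n: "n \<ge> 1" "n = 2 ^ \<alpha> * N" and N: "odd N" and r: "r = 2 ^ (\<alpha> + 2)"
  shows "cheb_T n = smult (1 / 2) (\<Prod>j | j dvd N. pcompose (psi (r * j)) [:0, 2:])"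
proof -
  let ?J = "(\<lambda>j. r * j) ` {j. j dvd N}"
  let ?x = "\<lambda>i. cos (2 * pi * real (2 * i + 1) / real (4 * n))"
  have rN: "4 * n = r * N" using n r by simp
  have pos: "r > 0" "N > 0" "n > 0" using n r N by (auto intro: gr0I)
  have "cheb_T n = smult (1 / 2) (\<Prod>j\<in>?J. pcompose (psi j) [:0, 2:])"
  proof (rule eq_prod_psi[where n = n and S = "?x ` {..<n}"])
    show "finite ?J" using pos by simp
    show "0 \<notin> ?J" using pos by auto
    show "rpoly (cheb_T n) (cos (2 * pi / real l)) = 0" if "l \<in> ?J" for l
    proof -
      from that obtain j d where d: "l = r * j" "N = j * d" by blast
      have "odd d" "j > 0" using N d by (auto intro: gr0I)
      have "4 * real n = real r * (real j * real d)" using arg_cong[OF rN, of real] d by simp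
      \<comment> \<open>The cofactor \<open>d = N / j\<close> is odd, so the angle is an odd
        multiple of \<open>pi / 2\<close>, a zero of the cosine.\<close>
      hence "real n * (2 * pi / real l) = of_int (int d) * (pi / 2)"
        using d \<open>j > 0\<close> pos by (simp add: field_simps)
      hence "cos (real n * (2 * pi / real l)) = 0"
        unfolding cos_zero_iff_int using \<open>odd d\<close> by (intro exI[of _ "int d"]) auto
      thus ?thesis by (simp only: rpoly_cheb_T_cos)
    qed
    have "inj_on ?x {..<n}"
    proof (rule inj_onI)
      fix k l assume kl: "k \<in> {..<n}" "l \<in> {..<n}" "?x k = ?x l"
      have rng: "0 \<le> 2 * pi * real (2 * k + 1) / real (4 * n)"
           "2 * pi * real (2 * k + 1) / real (4 * n) \<le> pi"
        if "k \<in> {..<n}" for k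
      proof -
        have "2 * real (2 * k + 1) / real (4 * n) \<le> 1" using that by simp
        from mult_left_mono[OF this, of pi]
        show "2 * pi * real (2 * k + 1) / real (4 * n) \<le> pi" by (simp add: mult_ac)
      qed simp
      have "2 * pi * real (2 * k + 1) / real (4 * n) = 2 * pi * real (2 * l + 1) / real (4 * n)"
        by (rule cos_inj_pi[OF rng[OF kl(1)] rng[OF kl(2)] kl(3)])
      hence "real (2 * k + 1) = real (2 * l + 1)" using pos by (simp add: field_simps)
      thus "k = l" by simp
    qed
    thus "card (?x ` {..<n}) = n" by (simp add: card_image)
    show "\<exists>l\<in>?J. \<exists>a. coprime a l \<and> x = cos (2 * pi * real a / real l)" if "x \<in> ?x ` {..<n}" for x
    proof -
      from that obtain i where x: "x = ?x i" by auto
      define g where "g = gcd (2 * i + 1) N"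
      have "g \<noteq> 0" using pos by (simp add: g_def)
      obtain a j where aj: "2 * i + 1 = a * g" "N = j * g" "coprime a j"
        using gcd_coprime_exists[of "2 * i + 1" N] \<open>g \<noteq> 0\<close> unfolding g_def by blast
      \<comment> \<open>Hence \<open>a\<close> is odd and coprime to the power of two
        \<open>r\<close>.\<close>
      have "odd (a * g)" by (simp flip: aj(1))
      hence "coprime a (r * j)" using aj(3)
        unfolding r coprime_mult_right_iff coprime_power_right_iff by simp
      moreover have "r * j \<in> ?J" by (intro imageI) (simp add: aj(2))
      moreover have "real (2 * i + 1) / real (4 * n) = real a / real (r * j)"
        unfolding rN aj using \<open>g \<noteq> 0\<close> by simp
      hence "x = cos (2 * pi * real a / real (r * j))" by (simp only: x flip: times_divide_eq_right)
      ultimately show ?thesis by blast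
    qed
  qed (use coeff_cheb_T[OF n(1)] in \<open>simp_all add: degree_cheb_T\<close>)
  also have "(\<Prod>j\<in>?J. pcompose (psi j) [:0, 2:]) = (\<Prod>j | j dvd N. pcompose (psi (r * j)) [:0, 2:])"
    using pos by (subst prod.reindex) (auto intro: inj_onI)
  finally show ?thesis .
qed

theorem theorem1:
  fixes n :: nat
  assumes "n \<ge> 1"
  shows "cheb_U n = (\<Prod>j | j dvd 2 * n + 2 \<and> j \<noteq> 1 \<and> j \<noteq> 2. pcompose (psi j) [:0, 2:]) \<and>
         (\<forall>\<alpha> N r. n = 2 ^ \<alpha> * N \<and> odd N \<and> r = 2 ^ (\<alpha> + 2) \<longrightarrow>
            cheb_T n = smult (1 / 2) (\<Prod>j | j dvd N. pcompose (psi (r * j)) [:0, 2:]))"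
  using assms cheb_U_eq_prod_psi cheb_T_eq_prod_psi by blast

end
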